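(* Let $n\ge 2$ be an integer and let $\omega\in[0,2\pi]$. Let $A(\omega)$ and $B(\omega)$ be the $n\times n$ real matrices with entries, for $1\le i,j\le n$, $$a_{ij}(\omega)=\tfrac12(i+j-2)\cos(i\omega-j\omega),\qquad b_{ij}(\omega)=\tfrac12(i+j-2)\sin(i\omega-j\omega),$$ and let $P(\omega)=\begin{bmatrix} A(\omega) & B(\omega) \\ {} B(\omega)^T & A(\omega) \end{bmatrix}\in\mathbb{R}^{2n\times 2n}$. Then, counting multiplicity, $P(\omega)$ has 2 positive and 2 negative eigenvalues, where both positive eigenvalues equal $$\lambda_+=\frac n4\left(n-1+\sqrt{\frac{4n^2-6n+2}{3}}\right)$$ and both negative eigenvalues equal $$\lambda_-=\frac n4\left(n-1-\sqrt{\frac{4n^2-6n+2}{3}}\right).$$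
   Context: The matrix $P(\omega)$ is real symmetric, so its eigenvalues are real and are counted with multiplicity. *)

theory Defs
  imports Complex_Main "Jordan_Normal_Form.Char_Poly"
begin

(* Matrix rows and columns are numbered from 0, so the 1-based entry (i, j) of the
   mathematical definition is the entry (i - 1, j - 1) here. *)

definition A_mat :: "nat \<Rightarrow> real \<Rightarrow> real mat" where
  "A_mat n \<omega> = mat n n (\<lambda>(k, l). let i = real (k + 1); j = real (l + 1) in
     1 / 2 * (i + j - 2) * cos (i * \<omega> - j * \<omega>))"

definition B_mat :: "nat \<Rightarrow> real \<Rightarrow> real mat" where
  "B_mat n \<omega> = mat n n (\<lambda>(k, l). let i = real (k + 1); j = real (l + 1) in
     1 / 2 * (i + j - 2) * sin (i * \<omega> - j * \<omega>))"

definition P_mat :: "nat \<Rightarrow> real \<Rightarrow> real mat" where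
  "P_mat n \<omega> = four_block_mat (A_mat n \<omega>) (B_mat n \<omega>)
                               (transpose_mat (B_mat n \<omega>)) (A_mat n \<omega>)"

(* Real eigenvalues with algebraic multiplicity. For a real symmetric matrix this
   is the full spectrum, and algebraic and geometric multiplicities agree. *)

definition eigenvalue_mset :: "real mat \<Rightarrow> real multiset" where
  "eigenvalue_mset M = proots (char_poly M)"

definition lambda_plus :: "nat \<Rightarrow> real" where
  "lambda_plus n = real n / 4 * (real n - 1 + sqrt ((4 * real n ^ 2 - 6 * real n + 2) / 3))"

definition lambda_minus :: "nat \<Rightarrow> real" where
  "lambda_minus n = real n / 4 * (real n - 1 - sqrt ((4 * real n ^ 2 - 6 * real n + 2) / 3))"

end

theory Submission
  imports Defs
begin

text \<open>
  The \<open>2 \<times> 2\<close> block of \<^term>\<open>P_mat n \<omega>\<close> formed by the entries \<open>(k, l)\<close> (counted from 0) of its four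
  quarters is \<open>(k + l) / 2\<close> times the rotation by \<open>(l - k) \<omega>\<close>. Conjugating with the orthogonal
  matrix that rotates the \<open>k\<close>-th coordinate plane by \<open>- k \<omega>\<close> therefore removes \<open>\<omega>\<close> and leaves two
  copies of the matrix \<open>M\<close> with entries \<open>(k + l) / 2\<close>. This \<open>M\<close> has rank two: \<open>M = U V\<close> with \<open>U\<close> of
  two columns, so up to a power of \<open>x\<close> its characteristic polynomial is that of the
  \<open>2 \<times> 2\<close> matrix \<open>V U\<close>, with trace \<open>\<Sum>k\<close> and determinant \<open>((\<Sum>k)\<^sup>2 - n \<Sum>k\<^sup>2) / 4\<close>.
\<close>

lemma char_poly_matrix_four_block:
  fixes A B C D :: "'a :: comm_ring_1 mat"
  assumes "A \<in> carrier_mat n n" "B \<in> carrier_mat n m" "C \<in> carrier_mat m n" "D \<in> carrier_mat m m"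
  shows "char_poly_matrix (four_block_mat A B C D) =
    four_block_mat (char_poly_matrix A) (map_mat (\<lambda>a. [:- a:]) B)
      (map_mat (\<lambda>a. [:- a:]) C) (char_poly_matrix D)"
  by (rule eq_matI) (use assms in \<open>auto simp: char_poly_matrix_def\<close>)

text \<open>The characteristic matrix keeps the zero block, so its determinant factors over the
  diagonal blocks.\<close>

lemma char_poly_four_block_upper_right_zero:
  fixes A :: "'a :: idom mat"
  assumes "A \<in> carrier_mat n n" "C \<in> carrier_mat m n" "D \<in> carrier_mat m m"
  shows "char_poly (four_block_mat A (0\<^sub>m n m) C D) = char_poly A * char_poly D"
  unfolding char_poly_def char_poly_matrix_four_block[OF assms(1) zero_carrier_mat assms(2,3)]
  by (rule det_four_block_mat_upper_right_zero) (use assms in auto)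

lemma char_poly_zero_mat: "char_poly (0\<^sub>m n n :: 'a :: comm_ring_1 mat) = monom 1 n"
proof -
  have "char_poly (0\<^sub>m n n :: 'a mat) = (\<Prod>a\<leftarrow>diag_mat (0\<^sub>m n n :: 'a mat). [:- a, 1:])"
    by (rule char_poly_upper_triangular) auto
  also have "diag_mat (0\<^sub>m n n :: 'a mat) = replicate n 0"
    by (auto simp: diag_mat_def intro: nth_equalityI)
  also have "(\<Prod>a\<leftarrow>replicate n (0::'a). [:- a, 1:]) = monom 1 n"
    by (simp add: monom_altdef)
  finally show ?thesis .
qed

text \<open>
  Both sides are characteristic polynomials of block triangular matrices, which are conjugate
  via the unipotent matrix with upper right block \<open>U\<close>.
\<close>
lemma char_poly_mult_commute:
  fixes U V :: "'a :: idom mat"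
  assumes U: "U \<in> carrier_mat n m" and V: "V \<in> carrier_mat m n"
  shows "monom 1 m * char_poly (U * V) = monom 1 n * char_poly (V * U)"
proof -
  let ?L = "four_block_mat (U * V) (0\<^sub>m n m) V (0\<^sub>m m m)"
  let ?R = "four_block_mat (0\<^sub>m n n) (0\<^sub>m n m) V (V * U)"
  let ?T = "four_block_mat (1\<^sub>m n) U (0\<^sub>m m n) (1\<^sub>m m)"
  let ?T' = "four_block_mat (1\<^sub>m n) (- U) (0\<^sub>m m n) (1\<^sub>m m)"
  note carr = U V mult_carrier_mat[OF U V] mult_carrier_mat[OF V U]
  have neg_zero: "- 0\<^sub>m m m = (0\<^sub>m m m :: 'a mat)"
    by (rule eq_matI) auto
  have add_neg: "U + - U = 0\<^sub>m n m" "- U + U = 0\<^sub>m n m"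
    using U by (auto intro!: eq_matI)
  have TT': "?T * ?T' = 1\<^sub>m (n + m)"
    by (subst mult_four_block_mat[where ?n1.0 = n and ?n2.0 = m and ?nr1.0 = n and ?nr2.0 = m
          and ?nc1.0 = n and ?nc2.0 = m])
       (use carr in \<open>auto simp: neg_zero add_neg\<close>)
  have T'T: "?T' * ?T = 1\<^sub>m (n + m)"
    by (subst mult_four_block_mat[where ?n1.0 = n and ?n2.0 = m and ?nr1.0 = n and ?nr2.0 = m
          and ?nc1.0 = n and ?nc2.0 = m])
       (use carr in \<open>auto simp: neg_zero add_neg\<close>)
  have TR: "?T * ?R = four_block_mat (U * V) (U * (V * U)) V (V * U)"
    by (subst mult_four_block_mat[where ?n1.0 = n and ?n2.0 = m and ?nr1.0 = n and ?nr2.0 = m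
          and ?nc1.0 = n and ?nc2.0 = m])
       (use carr in auto)
  have LT: "?L * ?T = four_block_mat (U * V) (U * (V * U)) V (V * U)"
    by (subst mult_four_block_mat[where ?n1.0 = n and ?n2.0 = m and ?nr1.0 = n and ?nr2.0 = m
          and ?nc1.0 = n and ?nc2.0 = m])
       (use carr in \<open>auto simp: assoc_mult_mat[OF U V U]\<close>)
  have c: "{?L, ?R, ?T, ?T'} \<subseteq> carrier_mat (n + m) (n + m)"
    using carr by auto
  have "?T * ?R * ?T' = ?L * ?T * ?T'"
    by (simp only: TR LT)
  also have "\<dots> = ?L * (?T * ?T')"
    by (rule assoc_mult_mat) (use c in auto)
  also have "\<dots> = ?L"
    unfolding TT' using c by (intro right_mult_one_mat) auto
  finally have "similar_mat ?L ?R"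
    by (intro similar_matI[OF c TT' T'T]) simp
  then have "char_poly ?L = char_poly ?R"
    by (rule char_poly_similar)
  then show ?thesis
    using carr
    by (simp add: char_poly_four_block_upper_right_zero[of _ n _ m] char_poly_zero_mat mult.commute)
qed

lemma char_poly_2x2:
  fixes a b c d :: "'a :: idom"
  shows "char_poly (mat_of_rows_list 2 [[a, b], [c, d]]) = [:a * d - b * c, - (a + d), 1:]"
proof -
  let ?e = "\<lambda>x :: 'a poly. mat 1 1 (\<lambda>_. x)"
  have "char_poly_matrix (mat_of_rows_list 2 [[a, b], [c, d]]) =
      four_block_mat (?e [:-a, 1:]) (?e [:-b:]) (?e [:-c:]) (?e [:-d, 1:])"
    by (rule eq_matI)
       (auto simp: char_poly_matrix_def mat_of_rows_list_def less_Suc_eq numeral_2_eq_2)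
  \<comment> \<open>The block formula det(A D - B C) requires the lower blocks to commute; blocks of
    size 1 over a commutative ring do.\<close>
  moreover have "det (four_block_mat (?e [:-a, 1:]) (?e [:-b:]) (?e [:-c:]) (?e [:-d, 1:]))
      = det (?e [:-a, 1:] * ?e [:-d, 1:] - ?e [:-b:] * ?e [:-c:])"
    by (rule det_four_block_mat[of _ 1]) (auto simp: scalar_prod_def mult.commute intro!: eq_matI)
  ultimately show ?thesis
    unfolding char_poly_def by (subst (asm) det_single) (auto simp: scalar_prod_def algebra_simps)
qed

text \<open>This is \<open>A_mat n 0\<close>, while \<open>B_mat n 0\<close> vanishes.\<close>

definition half_sum_mat :: "nat \<Rightarrow> real mat" where
  "half_sum_mat n = mat n n (\<lambda>(k, l). (real k + real l) / 2)"

lemma half_sum_mat_carrier [simp]: "half_sum_mat n \<in> carrier_mat n n"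
  by (simp add: half_sum_mat_def)

lemma sum_real_lessThan: "(\<Sum>k<n. real k) = real n * (real n - 1) / 2"
  by (induction n) (auto simp: field_simps)

lemma sum_real_square_lessThan:
  "(\<Sum>k<n. (real k)\<^sup>2) = real n * (real n - 1) * (2 * real n - 1) / 6"
  by (induction n) (auto simp: field_simps power2_eq_square)

lemma lambda_sum: "lambda_plus n + lambda_minus n = real n * (real n - 1) / 2"
  by (simp add: lambda_plus_def lambda_minus_def field_simps)

lemma lambda_discriminant_factor:
  "(4 * real n ^ 2 - 6 * real n + 2) / 3 = 2 * (real n - 1) * (2 * real n - 1) / 3"
  by (simp add: field_simps power2_eq_square)

text \<open>A difference of squares. The right-hand side stays unsimplified so that it matches the
  determinant of \<open>V * U\<close> once the power sums are evaluated.\<close>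

lemma lambda_mult:
  assumes "n \<ge> 1"
  shows "lambda_plus n * lambda_minus n =
    ((real n * (real n - 1) / 2)\<^sup>2 - real n * (real n * (real n - 1) * (2 * real n - 1) / 6)) / 4"
proof -
  define s where "s = sqrt ((4 * real n ^ 2 - 6 * real n + 2) / 3)"
  have "s\<^sup>2 = 2 * (real n - 1) * (2 * real n - 1) / 3"
    unfolding s_def lambda_discriminant_factor using assms by (intro real_sqrt_pow2) simp
  moreover have "lambda_plus n = real n / 4 * (real n - 1 + s)"
      "lambda_minus n = real n / 4 * (real n - 1 - s)"
    by (simp_all only: lambda_plus_def lambda_minus_def s_def)
  then have "lambda_plus n * lambda_minus n = (real n)\<^sup>2 / 16 * ((real n - 1)\<^sup>2 - s\<^sup>2)"
    by (simp only:) (simp add: field_simps power2_eq_square)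
  ultimately have "lambda_plus n * lambda_minus n =
      (real n)\<^sup>2 / 16 * ((real n - 1)\<^sup>2 - 2 * (real n - 1) * (2 * real n - 1) / 3)"
    by (simp only:)
  then show ?thesis
    by (simp add: field_simps power2_eq_square)
qed

lemma lambda_signs:
  assumes "n \<ge> 2"
  shows "lambda_plus n > 0" "lambda_minus n < 0"
proof -
  define s where "s = sqrt ((4 * real n ^ 2 - 6 * real n + 2) / 3)"
  have n: "real n \<ge> 2" using assms by simp
  \<comment> \<open>After cancelling n - 1 > 0 this is 3 n - 3 < 4 n - 2. It makes the square root
    exceed n - 1, which fixes both signs.\<close>
  have "(real n - 1) * (real n - 1) < (real n - 1) * (2 * (2 * real n - 1) / 3)"
    using n by (intro mult_strict_left_mono) auto
  then have "(real n - 1)\<^sup>2 < (4 * real n ^ 2 - 6 * real n + 2) / 3"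
    unfolding lambda_discriminant_factor by (simp add: power2_eq_square field_simps)
  then have s: "real n - 1 < s"
    unfolding s_def by (rule real_less_rsqrt)
  show "lambda_plus n > 0" "lambda_minus n < 0"
    using n s by (auto simp: lambda_plus_def lambda_minus_def s_def[symmetric]
        intro!: mult_pos_pos mult_pos_neg)
qed

lemma char_poly_half_sum_mat:
  assumes "n \<ge> 2"
  shows "char_poly (half_sum_mat n) =
    monom 1 (n - 2) * ([:- lambda_plus n, 1:] * [:- lambda_minus n, 1:])"
proof -
  \<comment> \<open>The factorization reads (k + l) / 2 = (k / 2) * 1 + (1 / 2) * l.\<close>
  define U where "U = mat n 2 (\<lambda>(k, j). (if j = 0 then real k else 1) / 2)"
  define V where "V = mat 2 n (\<lambda>(i, l). if i = 0 then 1 else real l)"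
  let ?s = "\<Sum>k<n. real k" and ?q = "\<Sum>k<n. (real k)\<^sup>2"
  have U: "U \<in> carrier_mat n 2" and V: "V \<in> carrier_mat 2 n"
    by (auto simp: U_def V_def)
  have UV: "U * V = half_sum_mat n"
    by (rule eq_matI)
       (auto simp: U_def V_def half_sum_mat_def scalar_prod_def numeral_2_eq_2 add_divide_distrib)
  have VU: "V * U = mat_of_rows_list 2 [[?s / 2, n / 2], [?q / 2, ?s / 2]]"
    by (rule eq_matI)
       (auto simp: U_def V_def mat_of_rows_list_def scalar_prod_def less_Suc_eq numeral_2_eq_2
         sum_divide_distrib power2_eq_square atLeast0LessThan)
  \<comment> \<open>By Vieta it suffices to compare trace and determinant with the sum and product
    of the two lambdas.\<close>
  have "char_poly (V * U) = [:- lambda_plus n, 1:] * [:- lambda_minus n, 1:]"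
    using lambda_sum[of n] lambda_mult[of n] assms
    unfolding VU char_poly_2x2 sum_real_lessThan sum_real_square_lessThan
    by (simp add: power2_eq_square field_simps)
  then have "monom 1 2 * char_poly (half_sum_mat n) =
      monom 1 n * ([:- lambda_plus n, 1:] * [:- lambda_minus n, 1:])"
    using char_poly_mult_commute[OF U V] unfolding UV by simp
  \<comment> \<open>As n \<ge> 2, the factor x^2 on the left can be split off x^n and
    cancelled.\<close>
  also have "monom (1 :: real) n = monom 1 2 * monom 1 (n - 2)"
    using assms by (simp only: mult_monom le_add_diff_inverse mult_1_left)
  finally show ?thesis
    by (simp only: mult.assoc mult_cancel_left) simp
qed

text \<open>The angles depend only on index differences, so passing to indices from 0 leaves them
  unchanged.\<close>

lemma Suc_mult_diff: "real (k + 1) * \<omega> - real (l + 1) * \<omega> = real k * \<omega> - real l * \<omega>"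
  by (simp add: algebra_simps)

lemma A_mat_altdef:
  "A_mat n \<omega> = mat n n (\<lambda>(k, l). (real k + real l) / 2 * cos (real k * \<omega> - real l * \<omega>))"
  unfolding A_mat_def Let_def Suc_mult_diff by simp

lemma B_mat_altdef:
  "B_mat n \<omega> = mat n n (\<lambda>(k, l). (real k + real l) / 2 * sin (real k * \<omega> - real l * \<omega>))"
  unfolding B_mat_def Let_def Suc_mult_diff by simp

lemma P_mat_similar:
  "similar_mat (P_mat n \<omega>)
    (four_block_mat (half_sum_mat n) (0\<^sub>m n n) (0\<^sub>m n n) (half_sum_mat n))"
proof -
  let ?M = "half_sum_mat n"
  let ?D = "four_block_mat ?M (0\<^sub>m n n) (0\<^sub>m n n) ?M"
  \<comment> \<open>\<open>?Q\<close> acts on coordinates k and n + k as the rotation by -k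
    \<omega>; \<open>?R\<close> is its transpose and hence its inverse.\<close>
  let ?C = "mat_diag n (\<lambda>k. cos (real k * \<omega>))"
  let ?S = "mat_diag n (\<lambda>k. sin (real k * \<omega>))"
  let ?S' = "mat_diag n (\<lambda>k. - sin (real k * \<omega>))"
  let ?Q = "four_block_mat ?C ?S ?S' ?C"
  let ?R = "four_block_mat ?C ?S' ?S ?C"
  note mult = mult_four_block_mat[where ?n1.0 = n and ?n2.0 = n and ?nr1.0 = n and ?nr2.0 = n
          and ?nc1.0 = n and ?nc2.0 = n]
  note diag = mat_diag_mult_left[of _ n n] mat_diag_mult_right[of _ n n]
  have one: "mat_diag n f + mat_diag n g = 1\<^sub>m n" if "\<And>k. f k + g k = 1" for f g :: "nat \<Rightarrow> real"
    by (rule eq_matI) (auto simp: mat_diag_def that)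
  have zero: "mat_diag n f + mat_diag n g = 0\<^sub>m n n" if "\<And>k. f k + g k = 0" for f g :: "nat \<Rightarrow> real"
    by (rule eq_matI) (auto simp: mat_diag_def that)
  have sq: "cos x * cos x + sin x * sin x = 1" "sin x * sin x + cos x * cos x = 1" for x :: real
    using sin_cos_squared_add[of x] by (simp_all add: power2_eq_square)
  have QR: "?Q * ?R = 1\<^sub>m (n + n)"
    by (subst mult) (auto simp: mat_diag_diag one zero sq)
  have RQ: "?R * ?Q = 1\<^sub>m (n + n)"
    by (subst mult) (auto simp: mat_diag_diag one zero sq)
  have QD: "?Q * ?D = four_block_mat (?C * ?M) (?S * ?M) (?S' * ?M) (?C * ?M)"
    by (subst mult) (auto simp: mult_carrier_mat[of _ n n] left_mult_zero_mat[of _ n n] right_mult_zero_mat[of _ n n])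
  \<comment> \<open>Diagonal factors only scale rows and columns, so entrywise these are the
    subtraction formulas for cosine and sine.\<close>
  have blocks:
    "?C * ?M * ?C + ?S * ?M * ?S = A_mat n \<omega>"
    "?C * ?M * ?S' + ?S * ?M * ?C = B_mat n \<omega>"
    "?S' * ?M * ?C + ?C * ?M * ?S = transpose_mat (B_mat n \<omega>)"
    "?S' * ?M * ?S' + ?C * ?M * ?C = A_mat n \<omega>"
    by (auto intro!: eq_matI simp: diag A_mat_altdef B_mat_altdef half_sum_mat_def cos_diff sin_diff)
      (simp_all add: field_simps)
  have QDR: "?Q * ?D * ?R = P_mat n \<omega>"
    unfolding QD P_mat_def
    by (subst mult) (auto simp: mult_carrier_mat[of _ n n] blocks)
  show ?thesis
    by (rule similar_matI[OF _ QR RQ QDR[symmetric]])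
       (auto simp: P_mat_def A_mat_def B_mat_def)
qed

theorem corollary6:
  fixes n :: nat and \<omega> :: real
  assumes "n \<ge> 2" and "\<omega> \<in> {0..2 * pi}"
  shows "filter_mset (\<lambda>x. x > 0) (eigenvalue_mset (P_mat n \<omega>)) = {# lambda_plus n, lambda_plus n #}
       \<and> filter_mset (\<lambda>x. x < 0) (eigenvalue_mset (P_mat n \<omega>)) = {# lambda_minus n, lambda_minus n #}"
proof -
  \<comment> \<open>\<open>?p\<close> belongs to one copy of \<open>half_sum_mat n\<close>; the two
    copies account for every multiplicity being doubled.\<close>
  let ?p = "[:0, 1:] ^ (n - 2) * ([:- lambda_plus n, 1:] * [:- lambda_minus n, 1:])"
  have "char_poly (P_mat n \<omega>) = ?p * ?p"
    unfolding char_poly_similar[OF P_mat_similar]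
    by (subst char_poly_four_block_upper_right_zero)
       (simp_all only: half_sum_mat_carrier zero_carrier_mat char_poly_half_sum_mat[OF assms(1)]
          monom_altdef smult_1_left)
  moreover have "proots ?p = replicate_mset (n - 2) 0 + {# lambda_plus n, lambda_minus n #}"
    by (subst proots_mult | simp add: proots_power)+
  moreover have "?p \<noteq> 0"
    by (simp del: mult_pCons_left mult_pCons_right)
  ultimately have "eigenvalue_mset (P_mat n \<omega>) =
      (replicate_mset (n - 2) 0 + {# lambda_plus n, lambda_minus n #}) +
      (replicate_mset (n - 2) 0 + {# lambda_plus n, lambda_minus n #})"
    unfolding eigenvalue_mset_def by (simp only: proots_mult simp_thms)
  \<comment> \<open>The strict sign filters discard the zeros, and \<open>lambda_signs\<close> sorts
    the remaining four roots.\<close>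
  then show ?thesis
    using lambda_signs[OF assms(1)] by simp
qed

end
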